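(* Let $n$ be a positive integer such that the dihedral group $D_n$ of order $2n$ is non-nilpotent (i.e. $n$ is not a power of $2$, where $1=2^0$ counts as a power of $2$). Then $$\kappa(D_n)=\begin{cases} n+1 & \text{if } 2\nmid n,\\ m+1 & \text{if } 2\mid n \text{ and } n \text{ is not a power of } 2,\end{cases}$$ where, in the second case, $n=2^k m$ with $m\geq 3$ and $2\nmid m$.
   Context: $D_n$ denotes the dihedral group of order $2n$. For a finite group $G$, $\mathrm{nil}(G)=\{g\in G:\langle g,h\rangle \text{ is nilpotent for all } h\in G\}$. For a finite non-nilpotent group $G$, the nilpotent graph $\Gamma_{\mathfrak N}(G)$ is the simple undirected graph with vertex set $G-\mathrm{nil}(G)$ (set difference) in which two distinct vertices $g,h$ are adjacent if and only if $\langle g,h\rangle$ is nilpotent. $\kappa(G)$ denotes the number of connected components of $\Gamma_{\mathfrak N}(G)$. *)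

theory Defs
  imports "Graph_Theory.Digraph_Component" "HOL-Algebra.Generated_Groups"
begin

section \<open>Nilpotent groups\<close>

primrec lower_central :: "('a, 'b) monoid_scheme \<Rightarrow> nat \<Rightarrow> 'a set" where
  "lower_central G 0 = carrier G"
| "lower_central G (Suc c) = generate G
     (\<Union>x \<in> lower_central G c. \<Union>y \<in> carrier G.
        {x \<otimes>\<^bsub>G\<^esub> y \<otimes>\<^bsub>G\<^esub> inv\<^bsub>G\<^esub> x \<otimes>\<^bsub>G\<^esub> inv\<^bsub>G\<^esub> y})"

definition nilpotent_group :: "('a, 'b) monoid_scheme \<Rightarrow> bool" where
  "nilpotent_group G \<longleftrightarrow> group G \<and> (\<exists>c. lower_central G c = {\<one>\<^bsub>G\<^esub>})"

abbreviation nilpotent_pair :: "('a, 'b) monoid_scheme \<Rightarrow> 'a \<Rightarrow> 'a \<Rightarrow> bool" where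
  "nilpotent_pair G g h \<equiv> nilpotent_group (G\<lparr>carrier := generate G {g, h}\<rparr>)"


section \<open>The nilpotent graph\<close>

definition nil_set :: "('a, 'b) monoid_scheme \<Rightarrow> 'a set" where
  "nil_set G = {g \<in> carrier G. \<forall>h \<in> carrier G. nilpotent_pair G g h}"

text \<open>As usual in the graph library, an undirected edge is a pair of opposite arcs.\<close>

definition nilpotent_graph :: "('a, 'b) monoid_scheme \<Rightarrow> 'a pair_pre_digraph" where
  "nilpotent_graph G =
     \<lparr>pverts = carrier G - nil_set G,
      parcs = {(g, h). g \<in> carrier G - nil_set G \<and> h \<in> carrier G - nil_set G \<and>
                       g \<noteq> h \<and> nilpotent_pair G g h}\<rparr>"

lemma graph_nilpotent_graph:
  assumes "finite (carrier G)"
  shows "graph (with_proj (nilpotent_graph G))"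
proof -
  let ?V = "carrier G - nil_set G"
  have "parcs (nilpotent_graph G) \<subseteq> ?V \<times> ?V"
    by (auto simp: nilpotent_graph_def)
  moreover have "finite (?V \<times> ?V)"
    using assms by simp
  ultimately have "finite (parcs (nilpotent_graph G))"
    by (rule finite_subset)
  moreover have "sym (parcs (nilpotent_graph G))"
    by (auto simp: nilpotent_graph_def sym_def insert_commute)
  ultimately show ?thesis
    using assms
    by unfold_locales
       (auto simp: nilpotent_graph_def symmetric_def arc_to_ends_def)
qed

text \<open>The graph is symmetric, so its strongly connected components are its connected
  components.\<close>

definition num_components :: "('a, 'b) monoid_scheme \<Rightarrow> nat" where
  "num_components G = card (pre_digraph.sccs (with_proj (nilpotent_graph G)))"


section \<open>Dihedral groups\<close>

text \<open>The pair \<open>(i, b)\<close> stands for \<open>r\<^sup>i\<close> if \<open>b\<close> is false and for \<open>r\<^sup>i s\<close> if \<open>b\<close> is true,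
  where \<open>r\<close> is a rotation of order \<open>n\<close> and \<open>s\<close> a reflection with \<open>s r s = r\<^sup>-\<^sup>1\<close>.\<close>

definition dihedral_group :: "nat \<Rightarrow> (int \<times> bool) monoid" where
  "dihedral_group n =
     \<lparr>carrier = {0..<int n} \<times> UNIV,
      mult = (\<lambda>(i, a) (j, b). ((if a then i - j else i + j) mod int n, a \<noteq> b)),
      one = (0, False)\<rparr>"

lemma group_dihedral_group:
  assumes "n > 0"
  shows "group (dihedral_group n)"
proof (rule groupI, goal_cases)
  case (3 x y z)
  then show ?case
    by (auto simp: dihedral_group_def mod_simps algebra_simps)
next
  case (5 x)
  obtain i a where x: "x = (i, a)" by fastforce
  show ?case
  proof (rule bexI)
    let ?y = "if a then (i, a) else (- i mod int n, a)"
    show "?y \<otimes>\<^bsub>dihedral_group n\<^esub> x = \<one>\<^bsub>dihedral_group n\<^esub>"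
      by (simp add: dihedral_group_def x mod_simps)
    show "?y \<in> carrier (dihedral_group n)"
      using 5 assms by (auto simp: dihedral_group_def x)
  qed
qed (use assms in \<open>auto simp: dihedral_group_def\<close>)

lemma order_dihedral_group: "order (dihedral_group n) = 2 * n"
  by (simp add: order_def dihedral_group_def card_cartesian_product)

end

theory Submission
  imports Defs "HOL-Computational_Algebra.Primes"
begin

text \<open>
  Write \<open>n = 2\<^sup>k m\<close> with \<open>m\<close> odd. A commutator of a rotation \<open>r\<^sup>i\<close> with a reflection is
  \<open>r\<^sup>2\<^sup>i\<close>, and a commutator of two reflections \<open>r\<^sup>i s\<close>, \<open>r\<^sup>j s\<close> is \<open>r\<close> to the power
  \<open>2(i - j)\<close>. Hence each step of the lower central series doubles the exponents of the rotations.
  In a subgroup that contains a reflection, the series reaches the identity exactly when doubling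
  kills every rotation, that is, when \<open>m\<close> divides all their exponents
  (\<open>nilpotent_if_in_reflection_class\<close>, \<open>nilpotent_imp_exponent_dvd\<close>); a subgroup of rotations is
  abelian. For \<open>m = 1\<close> the whole group is nilpotent.

  For \<open>m \<ge> 3\<close> this says: \<open>r\<^sup>i\<close> lies in the nil set iff \<open>m\<close> divides \<open>i\<close>; no reflection does; two
  rotations always generate a nilpotent subgroup; two reflections \<open>r\<^sup>i s\<close> and \<open>r\<^sup>j s\<close> do so iff
  \<open>i\<close> and \<open>j\<close> agree modulo \<open>m\<close>; and a reflection together with a rotation outside the nil set
  never does. So on the vertices of the graph, generating a nilpotent subgroup is already an
  equivalence relation, and the components are its classes: one class of rotations and one class
  of reflections for each residue modulo \<open>m\<close>. For odd \<open>n\<close> one has \<open>m = n\<close>, so both cases of the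
  formula are the single count \<open>m + 1\<close>.
\<close>

section \<open>Lower central series inside a subgroup\<close>

abbreviation commutator :: "('a, 'b) monoid_scheme \<Rightarrow> 'a \<Rightarrow> 'a \<Rightarrow> 'a" where
  "commutator G x y \<equiv> x \<otimes>\<^bsub>G\<^esub> y \<otimes>\<^bsub>G\<^esub> inv\<^bsub>G\<^esub> x \<otimes>\<^bsub>G\<^esub> inv\<^bsub>G\<^esub> y"

text \<open>This is the usual domination of the lower central series by any descending central series,
  with the terms \<open>S c\<close> taken in the ambient group, where they are easier to describe.\<close>

lemma (in group) lower_central_subset_central_series:
  assumes K: "subgroup K G"
    and S: "\<And>c. subgroup (S c) G"
    and base: "K \<subseteq> S 0"
    and step: "\<And>c x y. \<lbrakk>x \<in> S c; x \<in> K; y \<in> K\<rbrakk> \<Longrightarrow> commutator G x y \<in> S (Suc c)"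
  shows "lower_central (G\<lparr>carrier := K\<rparr>) c \<subseteq> S c \<inter> K"
proof (induction c)
  case 0
  then show ?case using base by simp
next
  case (Suc c)
  let ?H = "G\<lparr>carrier := K\<rparr>"
  let ?C = "\<Union>x \<in> lower_central ?H c. \<Union>y \<in> K. {commutator ?H x y}"
  have C: "?C \<subseteq> S (Suc c) \<inter> K"
  proof clarify
    fix x y assume x: "x \<in> lower_central ?H c" and y: "y \<in> K"
    have xS: "x \<in> S c" "x \<in> K" using x Suc by auto
    have "commutator G x y \<in> K"
      using xS(2) y K by (simp add: subgroup.m_closed subgroup.m_inv_closed)
    then show "commutator ?H x y \<in> S (Suc c) \<inter> K"
      using step[OF xS y] xS(2) y K by simp
  qed
  have "generate ?H ?C = generate G ?C"
    by (rule generate_consistent) (use C K in blast)+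
  also have "\<dots> \<subseteq> S (Suc c) \<inter> K"
    by (rule generate_subgroup_incl[OF C]) (rule subgroups_Inter_pair[OF S K])
  finally show ?case by simp
qed

lemma (in group) one_in_lower_central:
  "\<one> \<in> lower_central G c"
  by (cases c) (auto intro: generate.one)

lemma (in group) commutator_in_lower_central:
  assumes "subgroup K G" "x \<in> lower_central (G\<lparr>carrier := K\<rparr>) c" "x \<in> K" "y \<in> K"
  shows "commutator G x y \<in> lower_central (G\<lparr>carrier := K\<rparr>) (Suc c)"
proof -
  have "commutator (G\<lparr>carrier := K\<rparr>) x y \<in> lower_central (G\<lparr>carrier := K\<rparr>) (Suc c)"
    unfolding lower_central.simps
    by (rule generate.incl, rule UN_I[OF assms(2)], rule UN_I[of y]) (use assms(4) in simp_all)
  then show ?thesis using assms by simp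
qed

lemma (in group) nilpotent_if_central_series:
  assumes "subgroup K G"
    and "\<And>c. subgroup (S c) G"
    and "K \<subseteq> S 0"
    and "\<And>c x y. \<lbrakk>x \<in> S c; x \<in> K; y \<in> K\<rbrakk> \<Longrightarrow> commutator G x y \<in> S (Suc c)"
    and "S c \<subseteq> {\<one>}"
  shows "nilpotent_group (G\<lparr>carrier := K\<rparr>)"
proof -
  interpret H: group "G\<lparr>carrier := K\<rparr>" using assms(1) by (rule subgroup_imp_group)
  have "lower_central (G\<lparr>carrier := K\<rparr>) c \<subseteq> {\<one>}"
    using lower_central_subset_central_series[of K S, OF assms(1-4)] assms(5) by blast
  moreover have "\<one> \<in> lower_central (G\<lparr>carrier := K\<rparr>) c"
    using H.one_in_lower_central by simp
  ultimately show ?thesis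
    unfolding nilpotent_group_def using H.group_axioms by auto
qed

section \<open>Subgroups of the dihedral group\<close>

lemma dihedral_carrier [simp]:
  "carrier (dihedral_group n) = {0..<int n} \<times> UNIV"
  by (simp add: dihedral_group_def)

lemma dihedral_mult [simp]:
  "(i, a) \<otimes>\<^bsub>dihedral_group n\<^esub> (j, b) = ((if a then i - j else i + j) mod int n, a \<noteq> b)"
  by (simp add: dihedral_group_def)

lemma dihedral_one [simp]:
  "\<one>\<^bsub>dihedral_group n\<^esub> = (0, False)"
  by (simp add: dihedral_group_def)

lemma dihedral_inv:
  assumes "n > 0" "(i, a) \<in> carrier (dihedral_group n)"
  shows "inv\<^bsub>dihedral_group n\<^esub> (i, a) = (if a then i else - i mod int n, a)"
proof -
  interpret group "dihedral_group n" using assms(1) by (rule group_dihedral_group)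
  show ?thesis
    by (rule inv_equality) (use assms in \<open>auto simp: mod_simps\<close>)
qed

lemma dihedral_commutator:
  assumes "n > 0" "(i, a) \<in> carrier (dihedral_group n)" "(j, b) \<in> carrier (dihedral_group n)"
  shows "commutator (dihedral_group n) (i, a) (j, b) =
    ((if a then if b then 2 * (i - j) else - 2 * j else if b then 2 * i else 0) mod int n, False)"
  using assms
  by (auto simp: dihedral_inv mod_simps)

definition rotations :: "nat \<Rightarrow> int \<Rightarrow> (int \<times> bool) set" where
  "rotations n d = {(i, b) \<in> carrier (dihedral_group n). \<not> b \<and> d dvd i}"

text \<open>For \<open>d\<close> dividing \<open>n\<close>, this is the dihedral subgroup generated by \<open>r\<^sup>d\<close> and the reflection
  \<open>r\<^sup>j s\<close>.\<close>

definition reflection_class :: "nat \<Rightarrow> int \<Rightarrow> int \<Rightarrow> (int \<times> bool) set" where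
  "reflection_class n d j =
     {(i, b) \<in> carrier (dihedral_group n). d dvd (if b then i - j else i)}"

lemma subgroup_rotations:
  assumes "n > 0" "d dvd int n"
  shows "subgroup (rotations n d) (dihedral_group n)"
proof -
  interpret group "dihedral_group n" using assms(1) by (rule group_dihedral_group)
  show ?thesis
  proof (rule subgroupI)
    show "rotations n d \<noteq> {}"
      using assms by (auto simp: rotations_def intro!: exI[of _ 0])
  qed (use assms in \<open>auto simp: rotations_def dihedral_inv dvd_mod_iff simp del: mod_minus_eq\<close>)
qed

lemma subgroup_reflection_class:
  assumes "n > 0" "d dvd int n"
  shows "subgroup (reflection_class n d j) (dihedral_group n)"
proof -
  interpret group "dihedral_group n" using assms(1) by (rule group_dihedral_group)
  \<comment> \<open>Membership only depends on exponents modulo \<open>d\<close>, and reduction modulo \<open>n\<close> keeps them.\<close>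
  have red: "d dvd x mod int n - y \<longleftrightarrow> d dvd x - y" for x y
  proof -
    have "x - y = (x mod int n - y) + int n * (x div int n)"
      using mult_div_mod_eq[of "int n" x] by linarith
    then show ?thesis using assms(2) by (metis dvd_add_left_iff dvd_mult2)
  qed
  show ?thesis
  proof (rule subgroupI)
    show "reflection_class n d j \<noteq> {}"
      using assms by (auto simp: reflection_class_def intro!: exI[of _ 0] exI[of _ False])
  next
    fix x y assume xy: "x \<in> reflection_class n d j" "y \<in> reflection_class n d j"
    obtain i a i' b where eq: "x = (i, a)" "y = (i', b)" by (cases x, cases y)
    have "d dvd (if a then i - j else i)" "d dvd (if b then i' - j else i')"
      using xy by (auto simp: eq reflection_class_def)
    note dvds = dvd_add[OF this] dvd_diff[OF this]
    show "x \<otimes>\<^bsub>dihedral_group n\<^esub> y \<in> reflection_class n d j"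
      using dvds assms by (auto simp: eq reflection_class_def red dvd_mod_iff algebra_simps)
  qed (use assms in \<open>auto simp: reflection_class_def dihedral_inv dvd_mod_iff split: if_splits\<close>)
qed

section \<open>Nilpotent subgroups of the dihedral group\<close>

lemma nilpotent_if_rotations:
  assumes n: "n > 0" and K: "subgroup K (dihedral_group n)" and sub: "K \<subseteq> rotations n 1"
  shows "nilpotent_group (dihedral_group n\<lparr>carrier := K\<rparr>)"
proof -
  interpret group "dihedral_group n" using n by (rule group_dihedral_group)
  let ?S = "\<lambda>c::nat. rotations n (if c = 0 then 1 else int n)"
  show ?thesis
  proof (rule nilpotent_if_central_series[where S = ?S and c = 1])
    fix c x y assume xy: "x \<in> K" "y \<in> K"
    then have "x \<in> rotations n 1" "y \<in> rotations n 1"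
      using sub by auto
    then obtain i j where "x = (i, False)" "y = (j, False)"
        "(i, False) \<in> carrier (dihedral_group n)" "(j, False) \<in> carrier (dihedral_group n)"
      by (cases x; cases y) (auto simp: rotations_def)
    then show "commutator (dihedral_group n) x y \<in> ?S (Suc c)"
      using n by (simp only: dihedral_commutator) (simp add: rotations_def)
  next
    show "?S 1 \<subseteq> {\<one>\<^bsub>dihedral_group n\<^esub>}"
      by (auto simp: rotations_def dest: zdvd_imp_le)
  qed (use n K sub in \<open>auto simp: subgroup_rotations\<close>)
qed

text \<open>Commutators first fall into the rotations with exponents divisible by \<open>m\<close>, and from then on
  each one doubles the exponent; so the rotations with exponents divisible by \<open>m\<close>, \<open>2 m\<close>, \<open>4 m\<close>
  and so on up to \<open>n\<close> form a central series below \<open>K\<close>.\<close>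

lemma nilpotent_if_in_reflection_class:
  assumes n: "n > 0" "n = 2 ^ k * m" and K: "subgroup K (dihedral_group n)"
    and sub: "K \<subseteq> reflection_class n (int m) j"
  shows "nilpotent_group (dihedral_group n\<lparr>carrier := K\<rparr>)"
proof -
  interpret group "dihedral_group n" using n(1) by (rule group_dihedral_group)
  \<comment> \<open>The minimum freezes the series once it is trivial, so that every term is a subgroup.\<close>
  define d where "d c = int (2 ^ min c k * m)" for c
  have d_dvd: "d c dvd int n" for c
    unfolding d_def n(2) int_dvd_int_iff by (intro mult_dvd_mono le_imp_power_dvd) auto
  have d_step: "d (Suc c) dvd 2 * x" if "d c dvd x" for c x
  proof -
    have "d (Suc c) dvd 2 * d c"
      by (cases "c < k") (auto simp: d_def min_def le_Suc_eq)
    then show ?thesis using that by (meson dvd_trans mult_dvd_mono dvd_refl)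
  qed
  have m_dvd: "int m dvd d c" for c by (simp add: d_def)
  let ?S = "\<lambda>c. case c of 0 \<Rightarrow> K | Suc c \<Rightarrow> rotations n (d c)"
  show ?thesis
  proof (rule nilpotent_if_central_series[where S = ?S and c = "Suc k"])
    fix c x y assume x: "x \<in> ?S c" "x \<in> K" and y: "y \<in> K"
    obtain i a i' b where eq: "x = (i, a)" "y = (i', b)" by (cases x, cases y)
    have xy: "x \<in> reflection_class n (int m) j" "y \<in> reflection_class n (int m) j"
      using x y sub by auto
    then have car: "(i, a) \<in> carrier (dihedral_group n)" "(i', b) \<in> carrier (dihedral_group n)"
      by (auto simp: eq reflection_class_def)
    have cls: "int m dvd (if a then i - j else i)" "int m dvd (if b then i' - j else i')"
      using xy by (auto simp: eq reflection_class_def)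
    let ?e = "if a then if b then 2 * (i - i') else - 2 * i' else if b then 2 * i else 0"
    have "d c dvd ?e"
    proof (cases c)
      case 0
      then have "d c = int m" by (simp add: d_def)
      moreover have "int m dvd 2 * (i - i')" if a b
        using dvd_mult[OF dvd_diff[OF cls], of 2] that by (simp add: algebra_simps)
      then have "int m dvd ?e"
        using cls by (cases a; cases b) simp_all
      ultimately show ?thesis by simp
    next
      case (Suc c')
      then have "\<not> a" "d c' dvd i" using x(1) by (auto simp: eq rotations_def)
      then show ?thesis using d_step[of c' i] Suc by auto
    qed
    then have "d c dvd ?e mod int n" using d_dvd by (simp only: dvd_mod)
    then show "commutator (dihedral_group n) x y \<in> ?S (Suc c)"
      unfolding eq dihedral_commutator[OF n(1) car] using n(1)
      by (simp add: rotations_def del: mod_mult_self1 mod_mult_self2)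
  next
    show "?S (Suc k) \<subseteq> {\<one>\<^bsub>dihedral_group n\<^esub>}"
      using n by (auto simp: rotations_def d_def dest: zdvd_imp_le)
  next
    show "subgroup (?S c) (dihedral_group n)" for c
      using K subgroup_rotations[OF n(1) d_dvd] by (cases c) auto
  qed (use K in auto)
qed

text \<open>Iterated commutators of \<open>r\<^sup>i\<close> with one reflection stay in the lower central series and
  double the exponent each time.\<close>

lemma doubled_rotation_in_lower_central:
  assumes n: "n > 0" and K: "subgroup K (dihedral_group n)"
    and i: "(i, False) \<in> K" and j: "(j, True) \<in> K"
  shows "(2 ^ c * i mod int n, False) \<in> lower_central (dihedral_group n\<lparr>carrier := K\<rparr>) c \<inter> K"
proof -
  interpret group "dihedral_group n" using n by (rule group_dihedral_group)
  have sub: "K \<subseteq> carrier (dihedral_group n)" using K by (rule subgroup.subset)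
  show ?thesis
  proof (induction c)
    case 0
    have "i mod int n = i" using i sub by auto
    then show ?case using i by simp
  next
    case (Suc c)
    let ?x = "(2 ^ c * i mod int n, False)"
    let ?z = "commutator (dihedral_group n) ?x (j, True)"
    have "?z = (2 * (2 ^ c * i mod int n) mod int n, False)"
      by (subst dihedral_commutator) (use n sub Suc j in auto)
    then have z: "?z = (2 ^ Suc c * i mod int n, False)"
      by (simp add: mod_simps mult.assoc)
    have "?z \<in> K"
      using Suc j K by (simp add: subgroup.m_closed subgroup.m_inv_closed del: dihedral_mult)
    moreover have "?z \<in> lower_central (dihedral_group n\<lparr>carrier := K\<rparr>) (Suc c)"
      using commutator_in_lower_central[OF K] Suc j by blast
    ultimately show ?case unfolding z by blast
  qed
qed

lemma nilpotent_imp_exponent_dvd: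
  assumes n: "n > 0" and K: "subgroup K (dihedral_group n)"
    and nil: "nilpotent_group (dihedral_group n\<lparr>carrier := K\<rparr>)"
    and "(i, False) \<in> K" "(j, True) \<in> K"
  obtains c where "int n dvd 2 ^ c * i"
proof -
  obtain c where "lower_central (dihedral_group n\<lparr>carrier := K\<rparr>) c = {(0, False)}"
    using nil by (auto simp: nilpotent_group_def)
  then have "2 ^ c * i mod int n = 0"
    using doubled_rotation_in_lower_central[OF n K assms(4,5), of c] by auto
  then show thesis using that by blast
qed

lemma nilpotent_imp_odd_part_dvd:
  assumes "n > 0" "n = 2 ^ k * m" "odd m" "subgroup K (dihedral_group n)"
    and "nilpotent_group (dihedral_group n\<lparr>carrier := K\<rparr>)"
    and "(i, False) \<in> K" "(j, True) \<in> K"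
  shows "int m dvd i"
proof -
  obtain c where "int n dvd 2 ^ c * i"
    using nilpotent_imp_exponent_dvd assms by metis
  then have "int m dvd 2 ^ c * i" using assms(2) by (metis dvd_mult_right of_nat_mult)
  moreover have "coprime (int m) (2 ^ c)" using assms(3) by simp
  ultimately show ?thesis by (simp add: coprime_dvd_mult_right_iff)
qed

lemma nilpotent_dihedral_iff:
  assumes "n > 0"
  shows "nilpotent_group (dihedral_group n) \<longleftrightarrow> (\<exists>j. n = 2 ^ j)"
proof -
  interpret group "dihedral_group n" using assms by (rule group_dihedral_group)
  have whole: "dihedral_group n\<lparr>carrier := carrier (dihedral_group n)\<rparr> = dihedral_group n"
    by simp
  show ?thesis
  proof
    assume nil: "nilpotent_group (dihedral_group n)"
    show "\<exists>j. n = 2 ^ j"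
    proof (cases "n = 1")
      case False
      have "(1, False) \<in> carrier (dihedral_group n)" "(0, True) \<in> carrier (dihedral_group n)"
        using assms False by auto
      then obtain c where "int n dvd 2 ^ c * 1"
        using nilpotent_imp_exponent_dvd[OF assms subgroup_self] nil unfolding whole by blast
      then have "n dvd 2 ^ c"
        by (metis int_dvd_int_iff mult.right_neutral of_nat_numeral of_nat_power)
      then show ?thesis using divides_primepow_nat[OF two_is_prime_nat] by blast
    qed (auto intro: exI[of _ 0])
  next
    assume "\<exists>j. n = 2 ^ j"
    then obtain k where "n = 2 ^ k * 1" by auto
    moreover have "carrier (dihedral_group n) \<subseteq> reflection_class n (int 1) 0"
      by (auto simp: reflection_class_def)
    ultimately show "nilpotent_group (dihedral_group n)"
      using nilpotent_if_in_reflection_class[OF assms _ subgroup_self] unfolding whole by blast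
  qed
qed

section \<open>Nilpotent pairs\<close>

context
  fixes n k m :: nat
  assumes n_pos: "n > 0" and n_eq: "n = 2 ^ k * m" and m_odd: "odd m"
begin

interpretation D: group "dihedral_group n"
  using n_pos by (rule group_dihedral_group)

lemma int_m_dvd_n: "int m dvd int n"
  by (simp add: n_eq)

lemma nilpotent_pair_if_reflection_class:
  assumes "g \<in> reflection_class n (int m) j" "h \<in> reflection_class n (int m) j"
  shows "nilpotent_pair (dihedral_group n) g h"
proof -
  have "generate (dihedral_group n) {g, h} \<subseteq> reflection_class n (int m) j"
    using assms by (intro D.generate_subgroup_incl subgroup_reflection_class n_pos int_m_dvd_n) auto
  moreover have "{g, h} \<subseteq> carrier (dihedral_group n)"
    using assms by (auto simp: reflection_class_def)
  ultimately show ?thesis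
    using nilpotent_if_in_reflection_class[OF n_pos n_eq] D.generate_is_subgroup by blast
qed

lemma nilpotent_pair_rotations:
  assumes "(i, False) \<in> carrier (dihedral_group n)" "(j, False) \<in> carrier (dihedral_group n)"
  shows "nilpotent_pair (dihedral_group n) (i, False) (j, False)"
proof -
  have "generate (dihedral_group n) {(i, False), (j, False)} \<subseteq> rotations n 1"
    using assms
    by (intro D.generate_subgroup_incl subgroup_rotations n_pos) (auto simp: rotations_def)
  moreover have "{(i, False), (j, False)} \<subseteq> carrier (dihedral_group n)"
    using assms by simp
  ultimately show ?thesis
    by (intro nilpotent_if_rotations[OF n_pos] D.generate_is_subgroup)
qed

lemma nilpotent_pair_rotation_reflection_iff:
  assumes "(i, False) \<in> carrier (dihedral_group n)" "(j, True) \<in> carrier (dihedral_group n)"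
  shows "nilpotent_pair (dihedral_group n) (i, False) (j, True) \<longleftrightarrow> int m dvd i"
proof
  let ?K = "generate (dihedral_group n) {(i, False), (j, True)}"
  assume nil: "nilpotent_pair (dihedral_group n) (i, False) (j, True)"
  have "subgroup ?K (dihedral_group n)"
    using assms by (intro D.generate_is_subgroup) blast
  then show "int m dvd i"
    by (rule nilpotent_imp_odd_part_dvd[OF n_pos n_eq m_odd _ nil]) (auto intro: generate.incl)
next
  assume "int m dvd i"
  then show "nilpotent_pair (dihedral_group n) (i, False) (j, True)"
    using assms
    by (intro nilpotent_pair_if_reflection_class[where j = j]) (auto simp: reflection_class_def)
qed

lemma nilpotent_pair_reflections_iff:
  assumes "(i, True) \<in> carrier (dihedral_group n)" "(j, True) \<in> carrier (dihedral_group n)"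
  shows "nilpotent_pair (dihedral_group n) (i, True) (j, True) \<longleftrightarrow> i mod int m = j mod int m"
proof
  let ?K = "generate (dihedral_group n) {(i, True), (j, True)}"
  assume nil: "nilpotent_pair (dihedral_group n) (i, True) (j, True)"
  have K: "subgroup ?K (dihedral_group n)"
    using assms by (intro D.generate_is_subgroup) blast
  have refl: "(i, True) \<in> ?K" "(j, True) \<in> ?K" by (auto intro: generate.incl)
  \<comment> \<open>The product of the two reflections is a rotation by their difference.\<close>
  have "((i - j) mod int n, False) \<in> ?K"
    using subgroup.m_closed[OF K refl] by simp
  then have "int m dvd (i - j) mod int n"
    using nilpotent_imp_odd_part_dvd[OF n_pos n_eq m_odd K nil] refl by blast
  then show "i mod int m = j mod int m"
    using int_m_dvd_n by (simp add: dvd_mod_iff mod_eq_dvd_iff)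
next
  assume "i mod int m = j mod int m"
  then show "nilpotent_pair (dihedral_group n) (i, True) (j, True)"
    using assms by (intro nilpotent_pair_if_reflection_class[where j = j])
      (auto simp: reflection_class_def mod_eq_dvd_iff)
qed

lemma nil_set_dihedral:
  assumes "m > 1"
  shows "nil_set (dihedral_group n) = rotations n (int m)"
proof -
  have "m \<le> n" using int_m_dvd_n n_pos by (simp add: dvd_imp_le)
  \<comment> \<open>The rotation \<open>r\<close> keeps every reflection out of the nil set, and the reflection \<open>s\<close> keeps out
    the rotations with exponents not divisible by \<open>m\<close>.\<close>
  then have r: "(1, False) \<in> carrier (dihedral_group n)" "(0, True) \<in> carrier (dihedral_group n)"
    using assms by auto
  have "g \<in> nil_set (dihedral_group n) \<longleftrightarrow> g \<in> rotations n (int m)"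
    if g: "g \<in> carrier (dihedral_group n)" for g
  proof (cases g)
    case (Pair i b)
    show ?thesis
    proof (cases b)
      case True
      have "\<not> nilpotent_pair (dihedral_group n) g (1, False)"
        using nilpotent_pair_rotation_reflection_iff[OF r(1), of i] g assms Pair True
        by (simp add: insert_commute)
      then have "g \<notin> nil_set (dihedral_group n)"
        using r(1) unfolding nil_set_def by blast
      then show ?thesis using Pair True by (simp add: rotations_def)
    next
      case False
      have "nilpotent_pair (dihedral_group n) g h"
        if "int m dvd i" "h \<in> carrier (dihedral_group n)" for h
        using that g Pair False nilpotent_pair_rotations nilpotent_pair_rotation_reflection_iff
        by (cases h, cases "snd h") auto
      moreover have "int m dvd i" if "nilpotent_pair (dihedral_group n) g (0, True)"
        using that nilpotent_pair_rotation_reflection_iff[OF _ r(2)] g Pair False by simp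
      ultimately have "g \<in> nil_set (dihedral_group n) \<longleftrightarrow> int m dvd i"
        using g r(2) unfolding nil_set_def by blast
      then show ?thesis using g Pair False by (simp add: rotations_def)
    qed
  qed
  moreover have "nil_set (dihedral_group n) \<subseteq> carrier (dihedral_group n)"
    by (simp add: nil_set_def)
  moreover have "rotations n (int m) \<subseteq> carrier (dihedral_group n)"
    by (auto simp: rotations_def)
  ultimately show ?thesis by blast
qed

section \<open>Counting the components\<close>

definition component_label :: "int \<times> bool \<Rightarrow> int option" where
  "component_label = (\<lambda>(i, b). if b then Some (i mod int m) else None)"

lemma nilpotent_pair_iff_label_eq:
  assumes "m > 1"
    and "g \<in> carrier (dihedral_group n) - nil_set (dihedral_group n)"
    and "h \<in> carrier (dihedral_group n) - nil_set (dihedral_group n)"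
  shows "nilpotent_pair (dihedral_group n) g h \<longleftrightarrow> component_label g = component_label h"
proof -
  obtain i a j b where eq: "g = (i, a)" "h = (j, b)" by (cases g, cases h)
  have car: "(i, a) \<in> carrier (dihedral_group n)" "(j, b) \<in> carrier (dihedral_group n)"
    and ndvd: "\<not> a \<Longrightarrow> \<not> int m dvd i" "\<not> b \<Longrightarrow> \<not> int m dvd j"
    using assms by (auto simp: eq nil_set_dihedral rotations_def)
  show ?thesis
    using car ndvd nilpotent_pair_rotations[of i j] nilpotent_pair_reflections_iff[of i j]
      nilpotent_pair_rotation_reflection_iff[of i j] nilpotent_pair_rotation_reflection_iff[of j i]
    by (cases a; cases b) (simp_all add: eq component_label_def insert_commute)
qed

lemma label_image:
  assumes "m > 1"
  shows "component_label ` (carrier (dihedral_group n) - nil_set (dihedral_group n)) =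
    insert None (Some ` {0..<int m})"
proof -
  let ?V = "carrier (dihedral_group n) - nil_set (dihedral_group n)"
  have le: "m \<le> n" using int_m_dvd_n n_pos by (simp add: dvd_imp_le)
  have "(1, False) \<in> ?V" using le assms by (auto simp: nil_set_dihedral rotations_def)
  then have "None \<in> component_label ` ?V"
    by (rule rev_image_eqI) (simp add: component_label_def)
  moreover have "Some x \<in> component_label ` ?V" if "x \<in> {0..<int m}" for x
  proof (rule rev_image_eqI[of "(x, True)"])
    show "(x, True) \<in> ?V" using le that assms by (auto simp: nil_set_dihedral rotations_def)
  qed (use that in \<open>simp add: component_label_def\<close>)
  moreover have "component_label ` ?V \<subseteq> insert None (Some ` {0..<int m})"
    using assms by (auto simp: component_label_def split: if_splits)
  ultimately show ?thesis by blast
qed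

end

text \<open>A graph whose adjacency is equality of labels is a disjoint union of complete graphs, one
  for each label.\<close>

lemma card_sccs_label_graph:
  assumes arcs: "parcs P = {(u, v). u \<in> pverts P \<and> v \<in> pverts P \<and> u \<noteq> v \<and> f u = f v}"
  shows "card (pre_digraph.sccs (with_proj P)) = card (f ` pverts P)"
proof -
  interpret wf_digraph "with_proj P"
    by unfold_locales (auto simp: arcs)
  have reach: "u \<rightarrow>\<^sup>*\<^bsub>with_proj P\<^esub> v \<longleftrightarrow> u \<in> pverts P \<and> v \<in> pverts P \<and> f u = f v" for u v
  proof
    assume "u \<rightarrow>\<^sup>*\<^bsub>with_proj P\<^esub> v"
    then show "u \<in> pverts P \<and> v \<in> pverts P \<and> f u = f v"
      by (induction rule: reachable_induct) (auto simp: arcs)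
  next
    assume "u \<in> pverts P \<and> v \<in> pverts P \<and> f u = f v"
    then show "u \<rightarrow>\<^sup>*\<^bsub>with_proj P\<^esub> v"
      by (cases "u = v") (auto simp: arcs intro!: reachable_adjI)
  qed
  let ?fibre = "\<lambda>y. {v \<in> pverts P. f v = y}"
  have "scc_of u = ?fibre (f u)" if "u \<in> pverts P" for u
    using that by (auto simp: scc_of_def reach)
  then have "sccs_verts = ?fibre ` f ` pverts P"
    by (auto simp: sccs_verts_conv_scc_of image_image)
  moreover have "inj_on ?fibre (f ` pverts P)"
    by (rule inj_onI) blast
  ultimately show ?thesis
    by (simp add: card_image flip: card_sccs_verts)
qed

lemma num_components_dihedral:
  assumes "n = 2 ^ k * m" "odd m" "m > 1"
  shows "num_components (dihedral_group n) = m + 1"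
proof -
  let ?P = "nilpotent_graph (dihedral_group n)"
  have n: "n > 0" using assms by simp
  have "parcs ?P = {(u, v). u \<in> pverts ?P \<and> v \<in> pverts ?P \<and> u \<noteq> v \<and>
      component_label m u = component_label m v}"
    unfolding nilpotent_graph_def pair_pre_digraph.simps
    using nilpotent_pair_iff_label_eq[OF n assms] by blast
  then have "num_components (dihedral_group n) = card (component_label m ` pverts ?P)"
    unfolding num_components_def
    by (rule card_sccs_label_graph)
  also have "\<dots> = card (insert None (Some ` {0..<int m}))"
    using label_image[OF n assms] by (simp add: nilpotent_graph_def)
  also have "\<dots> = m + 1"
    by (simp add: card_image)
  finally show ?thesis .
qed

theorem theorem5p1:
  fixes n :: nat
  assumes "n > 0"
  shows "(\<not> nilpotent_group (dihedral_group n) \<longleftrightarrow> \<not> (\<exists>j. n = 2 ^ j)) \<and>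
    (\<not> nilpotent_group (dihedral_group n) \<longrightarrow>
      (\<not> 2 dvd n \<longrightarrow> num_components (dihedral_group n) = n + 1) \<and>
      (2 dvd n \<and> \<not> (\<exists>j. n = 2 ^ j) \<longrightarrow>
        (\<exists>k m. n = 2 ^ k * m \<and> m \<ge> 3 \<and> \<not> 2 dvd m \<and>
               num_components (dihedral_group n) = m + 1)))"
proof -
  have count: "\<exists>k m. n = 2 ^ k * m \<and> m \<ge> 3 \<and> odd m \<and> num_components (dihedral_group n) = m + 1"
    if not_pow: "\<not> (\<exists>j. n = 2 ^ j)"
  proof -
    obtain m where m: "n = 2 ^ multiplicity 2 n * m" "odd m"
      using multiplicity_decompose'[of n 2] assms by auto
    have "m \<noteq> 1" using m(1) not_pow by (metis mult.right_neutral)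
    then have "m \<ge> 3" using m(2) by (cases "m = 0"; cases "m = 2") auto
    then show ?thesis using m num_components_dihedral[OF m] by auto
  qed
  have "num_components (dihedral_group n) = n + 1" if odd: "odd n" and not_pow: "\<not> (\<exists>j. n = 2 ^ j)"
  proof -
    obtain k m where "n = 2 ^ k * m" "num_components (dihedral_group n) = m + 1"
      using count[OF not_pow] by blast
    then show ?thesis using odd by (cases k) auto
  qed
  then show ?thesis
    using nilpotent_dihedral_iff[OF assms] count by auto
qed

end
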